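(* Let $N\ge1$ be an integer and $\mathbf t=(k_0,\ell_0,\ldots,k_{N-1},\ell_{N-1})\in\overline{\mathbb N}_+^{2N}$. Then, as formal power series in $\alpha,\beta$, \[ \gamma_{\mathbf t}(\alpha,\beta)=\sum_{0\le n\le N}(-1)^n\,\mathfrak g_{N,n}(\alpha,\beta)\,\mathfrak C_{N,n}(\alpha,\beta), \] where \[ \mathfrak g_{N,n}(\alpha,\beta)=(\alpha\beta)^{N-n}\frac{(1-\alpha-\beta)^n}{\bigl((1-\alpha)(1-\beta)\bigr)^N},\qquad \mathfrak C_{N,n}(\alpha,\beta)=\sum_{\substack{\boldsymbol\tau\in\{0,1\}^{2N}\\ |\boldsymbol\tau|_{10}=n}}(-1)^{|\boldsymbol\tau|_1}\alpha^{\boldsymbol\tau\cdot\mathbf t_{\mathsf e}}\beta^{\boldsymbol\tau\cdot\mathbf t_{\mathsf o}}. \]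
   Context: Let $\overline{\mathbb N}_+=\{1,2,3,\ldots\}\cup\{\infty\}$. Let $\alpha,\beta$ be formal variables, $A_0=\begin{pmatrix}1&0\\ \alpha&\beta\end{pmatrix}$, $A_1=\begin{pmatrix}\alpha&\beta\\0&1\end{pmatrix}$ over $\mathbb C[[\alpha,\beta]]$, with usual powers for finite exponents and $A_0^\infty=\begin{pmatrix}1&0\\ \frac{\alpha}{1-\beta}&0\end{pmatrix}$, $A_1^\infty=\begin{pmatrix}0&\frac{\beta}{1-\alpha}\\0&1\end{pmatrix}$. For $\mathbf t=(k_0,\ell_0,\ldots,k_{N-1},\ell_{N-1})$, $\gamma_{\mathbf t}(\alpha,\beta)$ is the top-left entry of $A_1^{k_0}A_0^{\ell_0}\cdots A_1^{k_{N-1}}A_0^{\ell_{N-1}}$. Put $\mathbf t_{\mathsf e}=(k_0,0,k_1,0,\ldots,k_{N-1},0)$ and $\mathbf t_{\mathsf o}=(0,\ell_0,0,\ell_1,\ldots,0,\ell_{N-1})$. For $\boldsymbol\tau=(\tau_0,\ldots,\tau_{2N-1})\in\{0,1\}^{2N}$: $|\boldsymbol\tau|_1=\#\{j:\tau_j=1\}$, $|\boldsymbol\tau|_{10}=\#\{0\le j<2N-1:(\tau_j,\tau_{j+1})=(1,0)\}$, and $\boldsymbol\tau\cdot\mathbf u=\sum_j\tau_ju_j$ with the conventions $0\cdot\infty=0$, $a+\infty=\infty$, and $\alpha^\infty=\beta^\infty=0$. *)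

theory Defs
  imports
    Complex_Main
    "HOL-Library.Extended_Nat"
    "HOL-Computational_Algebra.Formal_Power_Series"
    "Jordan_Normal_Form.Matrix"
begin

text \<open>
  The ring of formal power series in two variables over the complex numbers is represented by
  iterated univariate series: the coefficient of \<open>\<alpha>^i \<beta>^j\<close> in \<open>f\<close> is
  \<open>fps_nth (fps_nth f j) i\<close>. Division is the library's division of formal power series; its
  denominators below are units, see the lemmas \<open>divide_one_minus_alpha\<close>,
  \<open>divide_one_minus_beta\<close> and \<open>divide_denominator\<close>.
\<close>

type_synonym bifps = "complex fps fps"

definition \<alpha> :: bifps where "\<alpha> = fps_const fps_X"

definition \<beta> :: bifps where "\<beta> = fps_X"

definition A0 :: "bifps mat" where
  "A0 = mat_of_rows_list 2 [[1, 0], [\<alpha>, \<beta>]]"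

definition A1 :: "bifps mat" where
  "A1 = mat_of_rows_list 2 [[\<alpha>, \<beta>], [0, 1]]"

fun A0_pow :: "enat \<Rightarrow> bifps mat" where
  "A0_pow (enat n) = A0 ^\<^sub>m n"
| "A0_pow \<infinity> = mat_of_rows_list 2 [[1, 0], [\<alpha> / (1 - \<beta>), 0]]"

fun A1_pow :: "enat \<Rightarrow> bifps mat" where
  "A1_pow (enat n) = A1 ^\<^sub>m n"
| "A1_pow \<infinity> = mat_of_rows_list 2 [[0, \<beta> / (1 - \<alpha>)], [0, 1]]"

text \<open>
  A tuple \<open>(k\<^sub>0, \<ell>\<^sub>0, \<dots>, k\<^sub>N\<^sub>-\<^sub>1, \<ell>\<^sub>N\<^sub>-\<^sub>1)\<close> is a flat list \<open>t\<close> of length \<open>2 * N\<close>, with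
  \<open>k\<^sub>i = t ! (2 * i)\<close> and \<open>\<ell>\<^sub>i = t ! (2 * i + 1)\<close>.
\<close>

definition gamma_mat :: "enat list \<Rightarrow> bifps mat" where
  "gamma_mat t =
     foldr (\<lambda>i M. A1_pow (t ! (2 * i)) * A0_pow (t ! (2 * i + 1)) * M)
       [0..<length t div 2] (1\<^sub>m 2)"

definition gamma :: "enat list \<Rightarrow> bifps" where
  "gamma t = gamma_mat t $$ (0, 0)"

definition even_part :: "enat list \<Rightarrow> enat list" where
  "even_part t = map (\<lambda>j. if even j then t ! j else 0) [0..<length t]"

definition odd_part :: "enat list \<Rightarrow> enat list" where
  "odd_part t = map (\<lambda>j. if odd j then t ! j else 0) [0..<length t]"

definition count_1 :: "nat list \<Rightarrow> nat" where
  "count_1 \<tau> = card {j. j < length \<tau> \<and> \<tau> ! j = 1}"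

definition count_10 :: "nat list \<Rightarrow> nat" where
  "count_10 \<tau> = card {j. j < length \<tau> - 1 \<and> \<tau> ! j = 1 \<and> \<tau> ! (j + 1) = 0}"

text \<open>Multiplication on \<^typ>\<open>enat\<close> satisfies \<open>0 * \<infinity> = 0\<close>.\<close>

definition dot :: "nat list \<Rightarrow> enat list \<Rightarrow> enat" where
  "dot \<tau> u = (\<Sum>j<length u. enat (\<tau> ! j) * u ! j)"

fun epow :: "bifps \<Rightarrow> enat \<Rightarrow> bifps" where
  "epow x (enat n) = x ^ n"
| "epow x \<infinity> = 0"

definition frak_g :: "nat \<Rightarrow> nat \<Rightarrow> bifps" where
  "frak_g N n = (\<alpha> * \<beta>) ^ (N - n) * ((1 - \<alpha> - \<beta>) ^ n / ((1 - \<alpha>) * (1 - \<beta>)) ^ N)"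

definition frak_C :: "nat \<Rightarrow> nat \<Rightarrow> enat list \<Rightarrow> bifps" where
  "frak_C N n t =
     (\<Sum>\<tau> | set \<tau> \<subseteq> {0, 1} \<and> length \<tau> = 2 * N \<and> count_10 \<tau> = n.
        (-1) ^ count_1 \<tau> * epow \<alpha> (dot \<tau> (even_part t)) * epow \<beta> (dot \<tau> (odd_part t)))"

lemma bifps_divide_mult_cancel:
  fixes f g :: bifps
  assumes "fps_nth (fps_nth g 0) 0 \<noteq> 0"
  shows "f / g * g = f"
proof -
  have "inverse (fps_nth g 0) * fps_nth g 0 = 1"
    using assms by (rule inverse_mult_eq_1)
  hence inv: "fps_nth g 0 * inverse (fps_nth g 0) = 1"
    by (simp add: mult.commute)
  have "fps_nth g 0 \<noteq> 0"
    using assms by auto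
  hence "f / g = f * inverse g"
    by (rule fps_divide_unit)
  moreover have "g * inverse g = 1"
    by (subst fps_inverse_def) (rule fps_right_inverse[OF inv])
  ultimately show ?thesis
    by (simp add: mult.assoc mult.commute[of "inverse g"])
qed

lemma divide_one_minus_alpha: "f / (1 - \<alpha>) * (1 - \<alpha>) = f"
  by (rule bifps_divide_mult_cancel) (simp add: \<alpha>_def)

lemma divide_one_minus_beta: "f / (1 - \<beta>) * (1 - \<beta>) = f"
  by (rule bifps_divide_mult_cancel) (simp add: \<beta>_def)

lemma divide_denominator:
  "f / ((1 - \<alpha>) * (1 - \<beta>)) ^ N * ((1 - \<alpha>) * (1 - \<beta>)) ^ N = f"
  by (rule bifps_divide_mult_cancel) (simp add: \<alpha>_def \<beta>_def fps_power_zeroth)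

end

theory Submission
  imports Defs
begin

text \<open>
  Put \<open>a = \<beta> / (1 - \<alpha>)\<close> and \<open>b = \<alpha> / (1 - \<beta>)\<close>. Both \<open>A\<^sub>1\<^sup>k\<close> and \<open>A\<^sub>0\<^sup>\<ell>\<close> are affine in \<open>\<alpha>\<^sup>k\<close> and
  \<open>\<beta>\<^sup>\<ell>\<close>, also for infinite exponents, so the matrix product expands into a sum over words \<open>\<tau>\<close>.
  Only \<open>p = a b\<close> and \<open>1 - p = (1 - \<alpha> - \<beta>) / ((1 - \<alpha>) (1 - \<beta>))\<close> occur as weights: a factor \<open>1 - p\<close>
  for each \<open>10\<close> in \<open>\<tau>\<close>, the remaining factors being \<open>p\<close>. Let \<open>R\<^sub>s\<close> be the weighted sum in which
  the words are counted as if preceded by the letter \<open>s\<close>. By induction on \<open>N\<close>, the first column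
  of the product is \<open>(R\<^sub>0, b (R\<^sub>0 - R\<^sub>1))\<close>.
\<close>

text \<open>The names follow the numerators: \<open>bq\<close> is the factor called a in the
  overview and \<open>aq\<close> is b, so that p is \<open>aq * bq\<close>.\<close>

definition bq :: bifps where "bq = \<beta> / (1 - \<alpha>)"

definition aq :: bifps where "aq = \<alpha> / (1 - \<beta>)"

lemma bq_mult: "bq * (1 - \<alpha>) = \<beta>"
  unfolding bq_def by (rule divide_one_minus_alpha)

lemma aq_mult: "aq * (1 - \<beta>) = \<alpha>"
  unfolding aq_def by (rule divide_one_minus_beta)

section \<open>Closed forms for the matrix powers\<close>

abbreviation mat2 :: "'a \<Rightarrow> 'a \<Rightarrow> 'a \<Rightarrow> 'a \<Rightarrow> 'a mat" where
  "mat2 a b c d \<equiv> mat_of_rows_list 2 [[a, b], [c, d]]"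

lemma mat2_mult:
  fixes a b c d :: "'a :: semiring_1"
  shows "mat2 a b c d * mat2 a' b' c' d' =
    mat2 (a * a' + b * c') (a * b' + b * d') (c * a' + d * c') (c * b' + d * d')"
  by (rule eq_matI)
    (auto simp: mat_of_rows_list_def scalar_prod_def less_Suc_eq numeral_2_eq_2)

lemma mat2_one: "1\<^sub>m 2 = mat2 1 0 0 (1 :: 'a :: semiring_1)"
  by (rule eq_matI) (auto simp: mat_of_rows_list_def less_Suc_eq numeral_2_eq_2)

lemma dim_row_mat2: "dim_row (mat2 a b c d) = 2"
  by (simp add: mat_of_rows_list_def)

text \<open>The upper right entry is \<beta> times a finite geometric sum in \<alpha>. The
  convention \<open>epow x \<infinity> = 0\<close> lets the same formula give the prescribed
  infinite power.\<close>

lemma A1_pow_eq: "A1_pow k = mat2 (epow \<alpha> k) (bq * (1 - epow \<alpha> k)) 0 1"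
proof (cases k)
  case (enat n)
  have "A1 ^\<^sub>m n = mat2 (\<alpha> ^ n) (bq * (1 - \<alpha> ^ n)) 0 1"
  proof (induction n)
    case 0
    show ?case by (simp add: A1_def dim_row_mat2 mat2_one)
  next
    case (Suc n)
    have "\<alpha> ^ n * \<beta> + bq * (1 - \<alpha> ^ n) = bq * (1 - \<alpha> ^ Suc n)"
      by (subst bq_mult[symmetric]) (simp add: algebra_simps)
    with Suc show ?case by (simp add: A1_def mat2_mult mult.commute)
  qed
  with enat show ?thesis by simp
qed (simp add: bq_def)

lemma A0_pow_eq: "A0_pow k = mat2 1 0 (aq * (1 - epow \<beta> k)) (epow \<beta> k)"
proof (cases k)
  case (enat n)
  have "A0 ^\<^sub>m n = mat2 1 0 (aq * (1 - \<beta> ^ n)) (\<beta> ^ n)"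
  proof (induction n)
    case 0
    show ?case by (simp add: A0_def dim_row_mat2 mat2_one)
  next
    case (Suc n)
    have "aq * (1 - \<beta> ^ n) + \<beta> ^ n * \<alpha> = aq * (1 - \<beta> ^ Suc n)"
      by (subst aq_mult[symmetric]) (simp add: algebra_simps)
    with Suc show ?case by (simp add: A0_def mat2_mult mult.commute)
  qed
  with enat show ?thesis by simp
qed (simp add: aq_def)

lemma gamma_mat_Nil: "gamma_mat [] = 1\<^sub>m 2"
  by (simp add: gamma_mat_def)

lemma gamma_mat_Cons2: "gamma_mat (k # l # t) = A1_pow k * A0_pow l * gamma_mat t"
proof -
  have "[0..<length (k # l # t) div 2] = 0 # map Suc [0..<length t div 2]"
    by (simp add: upt_conv_Cons map_Suc_upt del: upt_Suc)
  thus ?thesis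
    by (simp add: gamma_mat_def foldr_map comp_def)
qed

section \<open>Statistics of binary words\<close>

lemma card_less_Suc: "card {j. j < Suc n \<and> P j} = of_bool (P 0) + card {j. j < n \<and> P (Suc j)}"
proof -
  have "{j. j < Suc n \<and> P j} = (if P 0 then {0} else {}) \<union> Suc ` {j. j < n \<and> P (Suc j)}"
    by (auto simp: less_Suc_eq_0_disj)
  thus ?thesis
    by (auto simp: card_insert_if card_image)
qed

lemma count_1_Nil: "count_1 [] = 0"
  by (simp add: count_1_def)

lemma count_1_Cons: "count_1 (x # \<tau>) = of_bool (x = 1) + count_1 \<tau>"
  by (simp add: count_1_def card_less_Suc)

lemma count_10_singleton: "count_10 [x] = 0"
  by (simp add: count_10_def)

lemma count_10_Cons2: "count_10 (x # y # \<tau>) = of_bool (x = 1 \<and> y = 0) + count_10 (y # \<tau>)"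
  by (simp add: count_10_def card_less_Suc)

lemma count_10_Cons_0: "\<tau> \<noteq> [] \<Longrightarrow> count_10 (0 # \<tau>) = count_10 \<tau>"
  by (cases \<tau>) (simp_all add: count_10_Cons2)

text \<open>Occurrences of 10 do not overlap, and there are only 2N + 1 letters.\<close>

lemma count_10_le: "length \<tau> = 2 * N \<Longrightarrow> count_10 (s # \<tau>) \<le> N"
proof (induction N arbitrary: s \<tau>)
  case 0
  thus ?case by (simp add: count_10_singleton)
next
  case (Suc N)
  then obtain x y \<tau>' where \<tau>: "\<tau> = x # y # \<tau>'" "length \<tau>' = 2 * N"
    by (auto simp: length_Suc_conv)
  with Suc.IH[of \<tau>' y] show ?case by (auto simp: count_10_Cons2)
qed

lemma dot_Cons: "dot (x # \<tau>) (u # us) = enat x * u + dot \<tau> us"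
  by (simp add: dot_def lessThan_Suc_eq_insert_0 sum.reindex)

lemma even_part_Cons2: "even_part (k # l # t) = k # 0 # even_part t"
  by (rule nth_equalityI) (auto simp: even_part_def nth_Cons' Suc_diff_Suc simp del: upt_Suc)

lemma odd_part_Cons2: "odd_part (k # l # t) = 0 # l # odd_part t"
  by (rule nth_equalityI) (auto simp: odd_part_def nth_Cons' simp del: upt_Suc)

lemma epow_0: "epow x 0 = 1"
  by (simp add: zero_enat_def)

lemma epow_add: "epow x (m + n) = epow x m * epow x n"
  by (cases m; cases n) (simp_all add: power_add)

section \<open>Weighted sums over words\<close>

text \<open>The preceding letter \<open>s\<close> enters only the count of 10, not the sign or the
  exponents; \<open>length t div 2\<close> is N.\<close>

definition word_term :: "bifps \<Rightarrow> nat \<Rightarrow> enat list \<Rightarrow> nat list \<Rightarrow> bifps" where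
  "word_term p s t \<tau> =
     (-1) ^ count_10 (s # \<tau>) * p ^ (length t div 2 - count_10 (s # \<tau>)) * (1 - p) ^ count_10 (s # \<tau>) *
     ((-1) ^ count_1 \<tau> * epow \<alpha> (dot \<tau> (even_part t)) * epow \<beta> (dot \<tau> (odd_part t)))"

definition words :: "nat \<Rightarrow> nat list set" where
  "words n = {\<tau>. set \<tau> \<subseteq> {0, 1} \<and> length \<tau> = n}"

definition word_sum :: "bifps \<Rightarrow> nat \<Rightarrow> enat list \<Rightarrow> bifps" where
  "word_sum p s t = (\<Sum>\<tau>\<in>words (length t). word_term p s t \<tau>)"

lemma finite_words: "finite (words n)"
  unfolding words_def by (rule finite_lists_length_eq) simp

lemma words_0: "words 0 = {[]}"
  by (auto simp: words_def)

lemma sum_words_Suc: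
  "(\<Sum>\<tau>\<in>words (Suc n). f \<tau>) = (\<Sum>\<tau>\<in>words n. f (0 # \<tau>)) + (\<Sum>\<tau>\<in>words n. f (1 # \<tau>))"
proof -
  have "words (Suc n) = (#) 0 ` words n \<union> (#) 1 ` words n"
    by (auto simp: words_def length_Suc_conv)
  moreover have "(#) 0 ` words n \<inter> (#) (1 :: nat) ` words n = {}"
    by auto
  ultimately show ?thesis
    by (simp add: sum.union_disjoint finite_words sum.reindex)
qed

text \<open>Two letters are removed and \<open>y\<close> becomes the letter preceding the rest. At
  most one of the pairs \<open>s x\<close> and \<open>x y\<close> is 10, so exactly one weight
  splits off.\<close>

lemma word_term_Cons2:
  assumes "length t = 2 * N" "length \<tau> = 2 * N" "x \<in> {0, 1}" "y \<in> {0, 1}" "s \<in> {0, 1}"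
  shows "word_term p s (k # l # t) (x # y # \<tau>) =
    (if s = 1 \<and> x = 0 \<or> x = 1 \<and> y = 0 then - (1 - p) else p) *
    (if x = 1 then - epow \<alpha> k else 1) * (if y = 1 then - epow \<beta> l else 1) * word_term p y t \<tau>"
proof -
  define q where "q = 1 - p"
  define c where "c = count_10 (y # \<tau>)"
  define e :: nat where "e = of_bool (s = 1 \<and> x = 0) + of_bool (x = 1 \<and> y = 0)"
  define Z where "Z = (-1) ^ count_1 \<tau> * epow \<alpha> (dot \<tau> (even_part t)) * epow \<beta> (dot \<tau> (odd_part t))"
  \<comment> \<open>For \<open>z = 0\<close> the exponent vanishes even when \<open>u\<close> is
    infinite.\<close>
  have sign: "(-1) ^ of_bool (z = 1) * epow a (enat z * u) = (if z = 1 then - epow a u else 1)"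
    if "z \<in> {0, 1}" for z a u
    using that by (auto simp: epow_0 simp flip: zero_enat_def one_enat_def One_nat_def)
  \<comment> \<open>This keeps the truncated difference \<open>N - c\<close> honest:
    \<open>Suc N - c\<close> is \<open>Suc (N - c)\<close>.\<close>
  have "c \<le> N"
    unfolding c_def using assms by (intro count_10_le)
  have "word_term p s (k # l # t) (x # y # \<tau>) = (-1) ^ (e + c) * p ^ (Suc N - (e + c)) * q ^ (e + c) *
      (((-1) ^ of_bool (x = 1) * epow \<alpha> (enat x * k)) *
       ((-1) ^ of_bool (y = 1) * epow \<beta> (enat y * l)) * Z)"
    using assms(1)
    by (simp add: word_term_def count_10_Cons2 count_1_Cons even_part_Cons2 odd_part_Cons2 dot_Cons
        epow_add epow_0 power_add c_def e_def q_def Z_def add.assoc mult_ac del: One_nat_def)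
  also have "\<dots> = (-1) ^ (e + c) * p ^ (Suc N - (e + c)) * q ^ (e + c) *
      ((if x = 1 then - epow \<alpha> k else 1) * (if y = 1 then - epow \<beta> l else 1) * Z)"
    using assms by (simp only: sign)
  also have "(-1) ^ (e + c) * p ^ (Suc N - (e + c)) * q ^ (e + c) =
      (if e = 1 then - q else p) * ((-1) ^ c * p ^ (N - c) * q ^ c)"
  proof -
    have "e = 0 \<or> e = 1"
      by (auto simp: e_def)
    thus ?thesis
      using \<open>c \<le> N\<close> by (elim disjE) (simp_all add: Suc_diff_le mult_ac)
  qed
  also have "e = 1 \<longleftrightarrow> s = 1 \<and> x = 0 \<or> x = 1 \<and> y = 0"
    by (auto simp: e_def)
  finally have "word_term p s (k # l # t) (x # y # \<tau>) =
    (if s = 1 \<and> x = 0 \<or> x = 1 \<and> y = 0 then - q else p) * (if x = 1 then - epow \<alpha> k else 1) *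
    (if y = 1 then - epow \<beta> l else 1) * ((-1) ^ c * p ^ (N - c) * q ^ c * Z)"
    by (simp only: mult_ac)
  also have "(-1) ^ c * p ^ (N - c) * q ^ c * Z = word_term p y t \<tau>"
    using assms(1) by (simp add: word_term_def c_def q_def Z_def)
  finally show ?thesis
    unfolding q_def .
qed

lemma word_sum_Nil: "word_sum p s [] = 1"
  by (simp add: word_sum_def words_0 word_term_def count_10_singleton count_1_Nil dot_def
      even_part_def odd_part_def epow_0)

text \<open>The words are sorted by their first two letters. The result is linear in the two sums
  for \<open>t\<close>, just as the first column of the matrix product is linear in that of
  \<open>gamma_mat t\<close>.\<close>

lemma word_sum_Cons2:
  assumes "length t = 2 * N" "s \<in> {0, 1}"
  shows "word_sum p s (k # l # t) =
    (if s = 1 then - (1 - p) else p) * (word_sum p 0 t - epow \<beta> l * word_sum p 1 t) +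
    epow \<alpha> k * ((1 - p) * word_sum p 0 t + p * epow \<beta> l * word_sum p 1 t)"
proof -
  have "(\<Sum>\<tau>\<in>words (length t). word_term p s (k # l # t) (x # y # \<tau>)) =
    (if s = 1 \<and> x = 0 \<or> x = 1 \<and> y = 0 then - (1 - p) else p) *
    (if x = 1 then - epow \<alpha> k else 1) * (if y = 1 then - epow \<beta> l else 1) * word_sum p y t"
    if "x \<in> {0, 1}" "y \<in> {0, 1}" for x y
    unfolding word_sum_def sum_distrib_left
    using assms that by (intro sum.cong refl word_term_Cons2) (auto simp: words_def)
  note this[simp]
  have "word_sum p s (k # l # t) =
    (\<Sum>\<tau>\<in>words (length t). word_term p s (k # l # t) (0 # 0 # \<tau>)) +
    (\<Sum>\<tau>\<in>words (length t). word_term p s (k # l # t) (0 # 1 # \<tau>)) +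
    ((\<Sum>\<tau>\<in>words (length t). word_term p s (k # l # t) (1 # 0 # \<tau>)) +
    (\<Sum>\<tau>\<in>words (length t). word_term p s (k # l # t) (1 # 1 # \<tau>)))"
    by (subst word_sum_def) (simp only: list.size add_Suc_right add_0_right sum_words_Suc)
  thus ?thesis
    by (simp add: algebra_simps)
qed

text \<open>Left multiplication acts on each column separately, so the second column may stay
  unspecified.\<close>

lemma gamma_mat_first_column:
  assumes "length t = 2 * N"
  defines "R \<equiv> \<lambda>s. word_sum (aq * bq) s t"
  shows "\<exists>u v. gamma_mat t = mat2 (R 0) u (aq * (R 0 - R 1)) v"
  using assms(1) unfolding R_def
proof (induction N arbitrary: t)
  case 0
  thus ?case by (auto simp: gamma_mat_Nil word_sum_Nil mat2_one)
next
  case (Suc N)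
  then obtain k l t' where t: "t = k # l # t'" "length t' = 2 * N"
    by (auto simp: length_Suc_conv)
  obtain u v where uv: "gamma_mat t' = mat2 (word_sum (aq * bq) 0 t') u
      (aq * (word_sum (aq * bq) 0 t' - word_sum (aq * bq) 1 t')) v"
    using Suc.IH[OF t(2)] by blast
  show ?case
    \<comment> \<open>The power of \<open>A0\<close> turns the lower entry into
      \<open>aq * (R 0 - epow \<beta> l * R 1)\<close>, with \<open>R\<close> taken for
      \<open>t'\<close>, and the power of \<open>A1\<close> keeps it. It is \<open>aq\<close> times
      the difference of the new sums because p + (1 - p) = 1.\<close>
    unfolding t(1) gamma_mat_Cons2 uv A1_pow_eq A0_pow_eq mat2_mult
    by (intro exI arg_cong2[where f = "\<lambda>x y. mat2 x _ y _"])
      (simp_all add: word_sum_Cons2[OF t(2)] algebra_simps)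
qed

section \<open>From the word sum to the stated formula\<close>

lemma gamma_eq_word_sum:
  assumes "length t = 2 * N"
  shows "gamma t = word_sum (aq * bq) 0 t"
  using gamma_mat_first_column[OF assms] by (auto simp: gamma_def mat_of_rows_list_def)

text \<open>Multiplying p and 1 - p by the common denominator \<open>D\<close> gives \<alpha>
  \<beta> and 1 - \<alpha> - \<beta>; since n is at most N, the powers of \<open>D\<close> add up to
  \<open>D ^ N\<close>, which cancels.\<close>

lemma frak_g_eq:
  assumes "n \<le> N"
  shows "frak_g N n = (aq * bq) ^ (N - n) * (1 - aq * bq) ^ n"
proof -
  define D where "D = (1 - \<alpha>) * (1 - \<beta>)"
  have "fps_nth (fps_nth D 0) 0 = 1"
    by (simp add: D_def \<alpha>_def \<beta>_def)
  hence "D \<noteq> 0" by auto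
  have p: "aq * bq * D = \<alpha> * \<beta>"
    unfolding D_def by (subst aq_mult[symmetric], subst bq_mult[symmetric]) (simp add: mult_ac)
  have q: "(1 - aq * bq) * D = 1 - \<alpha> - \<beta>"
    unfolding left_diff_distrib p by (simp add: D_def algebra_simps)
  have "frak_g N n * D ^ N = (\<alpha> * \<beta>) ^ (N - n) * (1 - \<alpha> - \<beta>) ^ n"
    unfolding frak_g_def D_def mult.assoc[of "(\<alpha> * \<beta>) ^ (N - n)"] divide_denominator ..
  also have "\<dots> = (aq * bq) ^ (N - n) * (1 - aq * bq) ^ n * (D ^ (N - n) * D ^ n)"
    unfolding p[symmetric] q[symmetric] power_mult_distrib by (simp only: mult_ac)
  also have "D ^ (N - n) * D ^ n = D ^ N"
    using assms by (simp flip: power_add)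
  finally show ?thesis
    using \<open>D \<noteq> 0\<close> by simp
qed

theorem theorem3p1:
  fixes N :: nat and t :: "enat list"
  assumes "N \<ge> 1"
    and "length t = 2 * N"
    and "\<forall>u\<in>set t. u \<ge> 1"
  shows "gamma t = (\<Sum>n\<le>N. (-1) ^ n * frak_g N n * frak_C N n t)"
proof -
  \<comment> \<open>A leading 0 starts no 10; N being positive makes the word nonempty.\<close>
  have count: "count_10 (0 # \<tau>) = count_10 \<tau>" if "\<tau> \<in> words (2 * N)" for \<tau>
    using assms(1) that by (intro count_10_Cons_0) (auto simp: words_def)
  have count_le: "count_10 \<tau> \<le> N" if "\<tau> \<in> words (2 * N)" for \<tau>
    using count_10_le[of \<tau> N 0] count[OF that] that by (simp add: words_def)
  have "gamma t = (\<Sum>\<tau>\<in>words (2 * N). word_term (aq * bq) 0 t \<tau>)"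
    using gamma_eq_word_sum[OF assms(2)] assms(2) by (simp add: word_sum_def)
  \<comment> \<open>The words are grouped by their number of 10, which is at most N.\<close>
  also have "\<dots> = (\<Sum>n\<le>N. \<Sum>\<tau> | \<tau> \<in> words (2 * N) \<and> count_10 \<tau> = n. word_term (aq * bq) 0 t \<tau>)"
    using count_le by (intro sum.group[symmetric] finite_words) auto
  also have "\<dots> = (\<Sum>n\<le>N. (-1) ^ n * frak_g N n * frak_C N n t)"
  proof (intro sum.cong refl)
    fix n assume "n \<in> {..N}"
    hence "n \<le> N" by simp
    have "{\<tau>. set \<tau> \<subseteq> {0, 1} \<and> length \<tau> = 2 * N \<and> count_10 \<tau> = n} =
        {\<tau>. \<tau> \<in> words (2 * N) \<and> count_10 \<tau> = n}"
      by (auto simp: words_def)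
    thus "(\<Sum>\<tau> | \<tau> \<in> words (2 * N) \<and> count_10 \<tau> = n. word_term (aq * bq) 0 t \<tau>) =
      (-1) ^ n * frak_g N n * frak_C N n t"
      unfolding frak_C_def sum_distrib_left frak_g_eq[OF \<open>n \<le> N\<close>]
      by (intro sum.cong) (auto simp: word_term_def count assms(2) mult.assoc)
  qed
  finally show ?thesis .
qed

end
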